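(* Let $n$ be a positive integer. Every odd diagram class of $\mathfrak{S}_n$ contains at most one permutation avoiding the pattern $213$ and at most one permutation avoiding the pattern $312$. Moreover, if an odd diagram class $C$ contains a $213$-avoiding permutation $v$, then $v$ is the maximum of $C$ with respect to the Bruhat order (that is, $u \le v$ for all $u\in C$); and if $C$ contains a $312$-avoiding permutation $v'$, then $v'$ is the minimum of $C$ with respect to the Bruhat order (that is, $v' \le u$ for all $u \in C$).
   Context: $\mathfrak{S}_n$ is the symmetric group on $[n]=\{1,\dots,n\}$, with length $\ell(w)=|\{(i,j)\in[n]^2: i<j,\ w(i)>w(j)\}|$. The Bruhat order $\le$ on $\mathfrak{S}_n$ is the (reflexive) transitive closure of the relation $u\to v$ defined by: $vu^{-1}$ is a transposition and $\ell(u)<\ell(v)$. The diagram of $w\in\mathfrak{S}_n$ is $D(w)=\{(i,j)\in[n]^2 : j<w(i),\ w^{-1}(j)>i\}$, and the odd diagram of $w$ is $D_o(w)=\{(i,j)\in D(w): i\not\equiv w^{-1}(j) \pmod 2\}$. An odd diagram class of $\mathfrak{S}_n$ is a nonempty set of the form $\{w\in\mathfrak{S}_n : D_o(w)=D\}$ with $D\subseteq[n]^2$. A permutation $u$ contains the pattern $\alpha=\alpha_1\cdots\alpha_k$ if there are $1\le i_1<\dots<i_k\le n$ such that $u(i_1),\dots,u(i_k)$ are in the same relative order as $\alpha_1,\dots,\alpha_k$; otherwise $u$ avoids $\alpha$. *)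

theory Defs
  imports "HOL-Combinatorics.Permutations"
begin

text \<open>
  A permutation of \<open>[n] = {1,\<dots>,n}\<close> is a function \<open>w\<close> with \<open>w permutes {1..n}\<close>, so \<open>w\<close> is the
  identity outside \<open>[n]\<close>. The size \<open>n\<close> is an explicit parameter since it cannot be read off \<open>w\<close>.
\<close>

definition perm_length :: "nat \<Rightarrow> (nat \<Rightarrow> nat) \<Rightarrow> nat" where
  "perm_length n w = card {(i, j) \<in> {1..n} \<times> {1..n}. i < j \<and> w i > w j}"

definition bruhat_step :: "nat \<Rightarrow> (nat \<Rightarrow> nat) \<Rightarrow> (nat \<Rightarrow> nat) \<Rightarrow> bool" where
  "bruhat_step n u v \<longleftrightarrow>
     u permutes {1..n} \<and> v permutes {1..n} \<and>
     (\<exists>a\<in>{1..n}. \<exists>b\<in>{1..n}. a \<noteq> b \<and> v \<circ> inv u = Transposition.transpose a b) \<and>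
     perm_length n u < perm_length n v"

text \<open>The closure is a partial order on the permutations of \<open>[n]\<close> and plain equality elsewhere.\<close>

definition bruhat_le :: "nat \<Rightarrow> (nat \<Rightarrow> nat) \<Rightarrow> (nat \<Rightarrow> nat) \<Rightarrow> bool" where
  "bruhat_le n = (bruhat_step n)\<^sup>*\<^sup>*"

definition diagram :: "nat \<Rightarrow> (nat \<Rightarrow> nat) \<Rightarrow> (nat \<times> nat) set" where
  "diagram n w = {(i, j) \<in> {1..n} \<times> {1..n}. j < w i \<and> inv w j > i}"

definition odd_diagram :: "nat \<Rightarrow> (nat \<Rightarrow> nat) \<Rightarrow> (nat \<times> nat) set" where
  "odd_diagram n w = {(i, j) \<in> diagram n w. i mod 2 \<noteq> inv w j mod 2}"

definition odd_diagram_class :: "nat \<Rightarrow> (nat \<Rightarrow> nat) set \<Rightarrow> bool" where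
  "odd_diagram_class n C \<longleftrightarrow>
     C \<noteq> {} \<and>
     (\<exists>D \<subseteq> {1..n} \<times> {1..n}. C = {w. w permutes {1..n} \<and> odd_diagram n w = D})"

text \<open>
  A pattern is given by its one-line word; \<open>p\<close> lists the positions of an occurrence
  in increasing order.
\<close>

definition contains_pattern :: "nat \<Rightarrow> (nat \<Rightarrow> nat) \<Rightarrow> nat list \<Rightarrow> bool" where
  "contains_pattern n u \<alpha> \<longleftrightarrow>
     (\<exists>p. length p = length \<alpha> \<and> set p \<subseteq> {1..n} \<and> sorted_wrt (<) p \<and>
        (\<forall>r < length \<alpha>. \<forall>s < length \<alpha>. u (p ! r) < u (p ! s) \<longleftrightarrow> \<alpha> ! r < \<alpha> ! s))"

abbreviation avoids :: "nat \<Rightarrow> (nat \<Rightarrow> nat) \<Rightarrow> nat list \<Rightarrow> bool" where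
  "avoids n u \<alpha> \<equiv> \<not> contains_pattern n u \<alpha>"

end

theory Submission
  imports Defs
begin

text \<open>
  The proof rests on one kind of move that keeps the odd diagram. Let \<open>a < c\<close> be positions of
  equal parity with \<open>u a < u c\<close>, and suppose that at the positions of the other parity, the
  entries between \<open>a\<close> and \<open>c\<close> are below \<open>u a\<close> and no entry to the right of \<open>c\<close> is strictly between
  \<open>u a\<close> and \<open>u c\<close>. Exchanging the entries at \<open>a\<close> and \<open>c\<close> then changes no row and no column of the
  odd diagram, and it goes up in Bruhat order (\<open>even_swap_imp_bruhat_step\<close>). As \<open>a\<close> and \<open>c\<close> have
  equal parity, \<open>a + 1\<close> lies strictly between them; so positions \<open>a, a + 1, c\<close> carry the pattern
  \<open>213\<close> before the move and \<open>312\<close> after it. Hence no move leaves a \<open>213\<close>-avoiding permutation, and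
  no move arrives at a \<open>312\<close>-avoiding one.

  It remains to see that two distinct members \<open>u\<close>, \<open>v\<close> of a class always admit a move that brings
  them closer. There are two ways to find one.

  \<^item> Take the largest value \<open>y\<close> whose position differs in \<open>u\<close> and \<open>v\<close>. The permutation in which
    \<open>y\<close> stands further to the right admits a move up that puts \<open>y\<close> where the other one has it
    (\<open>largest_differing_value_even_ascent\<close>).
  \<^item> Take the first position \<open>p\<close> at which \<open>u\<close> and \<open>v\<close> differ. The permutation with the larger
    entry at \<open>p\<close> results from a move whose source has the smaller entry there
    (\<open>first_differing_position_even_ascent\<close>).

  If \<open>v\<close> avoids \<open>213\<close>, the moves of the first kind can never start at \<open>v\<close>, so they start at
  \<open>u\<close>, and repeating them leads from \<open>u\<close> up to \<open>v\<close>. If \<open>v\<close> avoids \<open>312\<close>, the moves of the second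
  kind can never end at \<open>v\<close>, so undoing them leads from \<open>u\<close> down to \<open>v\<close>. This gives the maximum
  and the minimum. It also gives uniqueness: a nontrivial chain of moves starts at a permutation
  containing \<open>213\<close> and ends at one containing \<open>312\<close>.
\<close>

section \<open>Rows of the odd diagram\<close>

lemma mem_odd_diagram_iff:
  assumes "w permutes {1..n}" "i \<in> {1..n}" "k \<in> {1..n}"
  shows "(i, w k) \<in> odd_diagram n w \<longleftrightarrow> i < k \<and> w k < w i \<and> i mod 2 \<noteq> k mod 2"
proof -
  have "w k \<in> {1..n}" using assms by (simp only: permutes_in_image)
  moreover have "inv w (w k) = k" using assms(1) by (rule permutes_inverses)
  ultimately show ?thesis
    using assms(2) by (auto simp: odd_diagram_def diagram_def)
qed

lemma odd_diagram_subset: "odd_diagram n w \<subseteq> {1..n} \<times> {1..n}"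
  by (auto simp: odd_diagram_def diagram_def)

lemma odd_diagram_less: "(i, j) \<in> odd_diagram n w \<Longrightarrow> j < w i"
  by (auto simp: odd_diagram_def diagram_def)

lemma odd_diagram_row:
  assumes w: "w permutes {1..n}" and i: "i \<in> {1..n}"
  shows "{j. (i, j) \<in> odd_diagram n w} =
         w ` {k. i < k \<and> k \<le> n \<and> i mod 2 \<noteq> k mod 2 \<and> w k < w i}" (is "?R = w ` ?K")
proof
  show "?R \<subseteq> w ` ?K"
  proof
    fix j assume j: "j \<in> ?R"
    then have "j \<in> w ` {1..n}"
      using odd_diagram_subset permutes_image[OF w] by blast
    then obtain k where "j = w k" "k \<in> {1..n}" by blast
    then show "j \<in> w ` ?K"
      using j mem_odd_diagram_iff[OF w i] by auto
  qed
  show "w ` ?K \<subseteq> ?R"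
    using mem_odd_diagram_iff[OF w i] i by auto
qed

lemma odd_diagram_eqI:
  assumes u: "u permutes {1..n}"
    and "\<And>i k. \<lbrakk>i \<in> {1..n}; k \<in> {1..n}\<rbrakk> \<Longrightarrow>
           (i, u k) \<in> odd_diagram n u \<longleftrightarrow> (i, u k) \<in> odd_diagram n v"
  shows "odd_diagram n u = odd_diagram n v"
proof -
  have "(i, j) \<in> odd_diagram n u \<longleftrightarrow> (i, j) \<in> odd_diagram n v"
    if "i \<in> {1..n}" "j \<in> {1..n}" for i j
  proof -
    have "j \<in> u ` {1..n}" using permutes_image[OF u] that by simp
    then show ?thesis using assms(2) that by blast
  qed
  then show ?thesis using odd_diagram_subset[of n u] odd_diagram_subset[of n v] by auto
qed

section \<open>Moves within an odd diagram class\<close>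

text \<open>``Even'' refers to the distance \<open>c - a\<close>.\<close>

definition even_ascent :: "nat \<Rightarrow> (nat \<Rightarrow> nat) \<Rightarrow> nat \<Rightarrow> nat \<Rightarrow> bool" where
  "even_ascent n u a c \<longleftrightarrow>
     1 \<le> a \<and> a < c \<and> c \<le> n \<and> a mod 2 = c mod 2 \<and> u a < u c \<and>
     (\<forall>b. a < b \<and> b < c \<and> b mod 2 \<noteq> a mod 2 \<longrightarrow> u b < u a) \<and>
     (\<forall>d. c < d \<and> d \<le> n \<and> d mod 2 \<noteq> a mod 2 \<longrightarrow> \<not> (u a < u d \<and> u d < u c))"

definition even_swap :: "nat \<Rightarrow> (nat \<Rightarrow> nat) \<Rightarrow> (nat \<Rightarrow> nat) \<Rightarrow> bool" where
  "even_swap n u v \<longleftrightarrow> u permutes {1..n} \<and>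
     (\<exists>a c. even_ascent n u a c \<and> v = u \<circ> Transposition.transpose a c)"

lemma permutes_comp_transpose:
  assumes "u permutes {1..n::nat}" "1 \<le> a" "a < c" "c \<le> n"
  shows "u \<circ> Transposition.transpose a c permutes {1..n}"
  using assms by (intro permutes_compose permutes_swap_id) auto

text \<open>
  Only the rows \<open>a\<close>, \<open>c\<close> and the columns \<open>u a\<close>, \<open>u c\<close> can change. The condition between \<open>a\<close> and
  \<open>c\<close> protects the columns, and together with the condition to the right of \<open>c\<close> it protects the
  rows.
\<close>

lemma odd_diagram_even_ascent_swap:
  assumes u: "u permutes {1..n}" and ac: "even_ascent n u a c"
  shows "odd_diagram n (u \<circ> Transposition.transpose a c) = odd_diagram n u"
proof -
  let ?t = "Transposition.transpose a c"
  have v: "u \<circ> ?t permutes {1..n}"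
    using u ac by (intro permutes_comp_transpose) (auto simp: even_ascent_def)
  have "odd_diagram n u = odd_diagram n (u \<circ> ?t)"
  proof (rule odd_diagram_eqI[OF u])
    fix i k assume i: "i \<in> {1..n}" and k: "k \<in> {1..n}"
    have t_in: "?t k \<in> {1..n}"
      using k ac by (auto simp: even_ascent_def Transposition.transpose_def)
    have "(i, (u \<circ> ?t) (?t k)) \<in> odd_diagram n (u \<circ> ?t) \<longleftrightarrow>
          i < ?t k \<and> u k < u (?t i) \<and> i mod 2 \<noteq> ?t k mod 2"
      using mem_odd_diagram_iff[OF v i t_in] by simp
    also have "\<dots> \<longleftrightarrow> i < k \<and> u k < u i \<and> i mod 2 \<noteq> k mod 2"
    proof -
      have lt: "a < c" "u a < u c" and par: "a mod 2 = c mod 2"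
        and mid: "\<And>b. \<lbrakk>a < b; b < c; b mod 2 \<noteq> a mod 2\<rbrakk> \<Longrightarrow> u b < u a"
        and right: "\<And>d. \<lbrakk>c < d; d \<le> n; d mod 2 \<noteq> a mod 2\<rbrakk> \<Longrightarrow> \<not> (u a < u d \<and> u d < u c)"
        using ac by (auto simp: even_ascent_def)
      have kn: "k \<le> n" using k by simp
      have inj: "u k = u a \<longleftrightarrow> k = a" using permutes_inj[OF u] by (simp add: inj_eq)
      consider "i \<in> {a, c}" "k \<in> {a, c}" | "i \<in> {a, c}" "k \<notin> {a, c}" |
        "i \<notin> {a, c}" "k \<in> {a, c}" | "i \<notin> {a, c}" "k \<notin> {a, c}" by blast
      then show ?thesis
      proof cases
        case 1
        then show ?thesis using lt par by (auto simp: Transposition.transpose_def)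
      next
        case 2
        have "u k < u a" if "u k < u c" "a < k" "k mod 2 \<noteq> a mod 2"
          using that mid[of k] right[of k] kn 2 inj
          by (metis insertCI linorder_neqE_nat)
        then show ?thesis using 2 lt par
          by (auto simp: Transposition.transpose_def)
      next
        case 3
        have "i < a \<longleftrightarrow> i < c" if "u a < u i" "i mod 2 \<noteq> a mod 2"
          using that mid[of i] lt 3 by (metis insertCI linorder_neqE_nat order.asym order.strict_trans)
        moreover have "?t i = i" using 3 by simp
        moreover have "u a < u i" if "u c < u i" using that lt by simp
        ultimately show ?thesis using 3 par by auto
      next
        case 4
        then show ?thesis by (simp add: Transposition.transpose_def)
      qed
    qed
    finally show "(i, u k) \<in> odd_diagram n u \<longleftrightarrow> (i, u k) \<in> odd_diagram n (u \<circ> ?t)"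
      using mem_odd_diagram_iff[OF u i k] by simp
  qed
  then show ?thesis by simp
qed

text \<open>
  Moving an inversion along with the transposition, whenever this keeps the order of its two
  positions, is an involution on the pairs of positions \<open>i < j\<close>. It injects the inversions of \<open>u\<close> into those of the new
  permutation, and misses the new inversion \<open>(a, c)\<close>.
\<close>

lemma perm_length_swap_less:
  assumes ac: "1 \<le> a" "a < c" "c \<le> n" and asc: "u a < u c"
  shows "perm_length n u < perm_length n (u \<circ> Transposition.transpose a c)"
proof -
  let ?t = "Transposition.transpose a c"
  define Inv where "Inv w = {(i, j) \<in> {1..n} \<times> {1..n}. i < j \<and> w i > w j}" for w :: "nat \<Rightarrow> nat"
  define f where "f = (\<lambda>(i, j). if ?t i < ?t j then (?t i, ?t j) else (i, j))"
  have fin: "finite (Inv w)" for w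
    by (rule finite_subset[of _ "{1..n} \<times> {1..n}"]) (auto simp: Inv_def)
  have invol: "f (f (i, j)) = (i, j)" if "i < j" for i j
    using that by (simp add: f_def)
  have inj: "inj_on f (insert (a, c) (Inv u))"
  proof (rule inj_on_inverseI)
    fix x assume "x \<in> insert (a, c) (Inv u)"
    then show "f (f x) = x" using ac(2) invol by (auto simp: Inv_def)
  qed
  have "f ` insert (a, c) (Inv u) \<subseteq> Inv (u \<circ> ?t)"
  proof -
    have "f (a, c) \<in> Inv (u \<circ> ?t)"
      using ac asc by (auto simp: f_def Inv_def)
    moreover have "f (i, j) \<in> Inv (u \<circ> ?t)" if "(i, j) \<in> Inv u" for i j
      using that ac asc by (auto simp: f_def Inv_def Transposition.transpose_def split: if_splits)
    ultimately show ?thesis by auto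
  qed
  then have "card (insert (a, c) (Inv u)) \<le> card (Inv (u \<circ> ?t))"
    using card_inj_on_le[OF inj _ fin] by simp
  moreover have "(a, c) \<notin> Inv u" using asc by (simp add: Inv_def)
  ultimately have "card (Inv u) < card (Inv (u \<circ> ?t))"
    using fin[of u] by simp
  then show ?thesis by (simp add: perm_length_def Inv_def)
qed

lemma even_swap_imp_bruhat_step:
  assumes "even_swap n u v"
  shows "bruhat_step n u v"
proof -
  obtain a c where u: "u permutes {1..n}" and asc: "even_ascent n u a c"
    and v: "v = u \<circ> Transposition.transpose a c"
    using assms by (auto simp: even_swap_def)
  have ac: "1 \<le> a" "a < c" "c \<le> n" "u a < u c" using asc by (auto simp: even_ascent_def)
  have "v \<circ> inv u = Transposition.transpose (u a) (u c)"
  proof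
    fix z
    have z: "u (inv u z) = z" using u by (rule permutes_inverses)
    have inj: "u i = u j \<longleftrightarrow> i = j" for i j using permutes_inj[OF u] by (simp add: inj_eq)
    show "(v \<circ> inv u) z = Transposition.transpose (u a) (u c) z"
      unfolding v comp_apply Transposition.transpose_def
      using z inj[of "inv u z" a] inj[of "inv u z" c] by auto
  qed
  moreover have "u a \<in> {1..n}" "u c \<in> {1..n}"
    using ac unfolding permutes_in_image[OF u] by auto
  moreover have "u a \<noteq> u c" using ac by simp
  moreover have "v permutes {1..n}"
    unfolding v using permutes_comp_transpose[OF u ac(1-3)] .
  moreover have "perm_length n u < perm_length n v"
    unfolding v by (rule perm_length_swap_less[OF ac])
  ultimately show ?thesis
    unfolding bruhat_step_def using u by blast
qed

lemma even_swap_rtranclp_imp_bruhat_le: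
  assumes "(even_swap n)\<^sup>*\<^sup>* u v"
  shows "bruhat_le n u v"
proof -
  have "even_swap n \<le> bruhat_step n"
    using even_swap_imp_bruhat_step by blast
  then show ?thesis
    unfolding bruhat_le_def using assms rtranclp_mono by blast
qed

section \<open>Patterns forced by a move\<close>

lemma contains_pattern_length3I:
  assumes "1 \<le> i" "i < j" "j < k" "k \<le> n"
    and "\<And>r s. \<lbrakk>r < 3; s < 3\<rbrakk> \<Longrightarrow>
      u ([i, j, k] ! r) < u ([i, j, k] ! s) \<longleftrightarrow> [x, y, z] ! r < [x, y, z] ! s"
  shows "contains_pattern n u [x, y, z]"
proof -
  have len: "length [x, y, z] = 3" by simp
  show ?thesis
    unfolding contains_pattern_def len
  proof (intro exI[of _ "[i, j, k]"] conjI allI impI)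
    show "set [i, j, k] \<subseteq> {1..n}" "sorted_wrt (<) [i, j, k]"
      using assms(1-4) by auto
  qed (use assms(5) in simp_all)
qed

lemma even_ascent_next:
  assumes "even_ascent n u a c"
  shows "Suc a < c" "u (Suc a) < u a"
proof -
  have par: "Suc a mod 2 \<noteq> a mod 2" by presburger
  have "c \<noteq> Suc a" "a < c" using assms par by (auto simp: even_ascent_def)
  then show "Suc a < c" by simp
  then show "u (Suc a) < u a" using assms par by (auto simp: even_ascent_def)
qed

lemma even_swap_source_contains_213:
  assumes "even_swap n u v"
  shows "contains_pattern n u [2, 1, 3]"
proof -
  obtain a c where asc: "even_ascent n u a c" using assms by (auto simp: even_swap_def)
  note nxt = even_ascent_next[OF asc]
  have less: "u (Suc a) < u a" "u a < u c"
    using asc nxt by (auto simp: even_ascent_def)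
  show ?thesis
  proof (rule contains_pattern_length3I[of a "Suc a" c])
    fix r s :: nat assume "r < 3" "s < 3"
    then have "r \<in> {0, 1, 2}" "s \<in> {0, 1, 2}" by auto
    then show "u ([a, Suc a, c] ! r) < u ([a, Suc a, c] ! s) \<longleftrightarrow>
               [2, 1, 3 :: nat] ! r < [2, 1, 3] ! s"
      using less by auto
  qed (use asc nxt in \<open>auto simp: even_ascent_def\<close>)
qed

lemma even_swap_target_contains_312:
  assumes "even_swap n u v"
  shows "contains_pattern n v [3, 1, 2]"
proof -
  obtain a c where asc: "even_ascent n u a c" and v: "v = u \<circ> Transposition.transpose a c"
    using assms by (auto simp: even_swap_def)
  note nxt = even_ascent_next[OF asc]
  have vals: "v a = u c" "v (Suc a) = u (Suc a)" "v c = u a"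
    using nxt by (auto simp: v Transposition.transpose_def)
  have less: "u (Suc a) < u a" "u a < u c"
    using asc nxt by (auto simp: even_ascent_def)
  show ?thesis
  proof (rule contains_pattern_length3I[of a "Suc a" c])
    fix r s :: nat assume "r < 3" "s < 3"
    then have "r \<in> {0, 1, 2}" "s \<in> {0, 1, 2}" by auto
    then show "v ([a, Suc a, c] ! r) < v ([a, Suc a, c] ! s) \<longleftrightarrow>
               [3, 1, 2 :: nat] ! r < [3, 1, 2] ! s"
      using less vals by auto
  qed (use asc nxt in \<open>auto simp: even_ascent_def\<close>)
qed

section \<open>Moving up to a 213-avoiding permutation\<close>

text \<open>
  In row \<open>q\<close> of \<open>v\<close>, whose entry is \<open>y\<close>, every later position of the other parity counts unless
  its entry exceeds \<open>y\<close>. Row \<open>q\<close> of \<open>u\<close> counts at most the same positions, since the entries above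
  \<open>y\<close> are common to both. The two rows being equal, \<open>u\<close> counts all of them: so \<open>p\<close>, where \<open>u\<close> has
  \<open>y\<close>, has the parity of \<open>q\<close>, and no later position of the other parity has its entry between
  \<open>u q\<close> and \<open>y\<close>. Column \<open>y\<close>, which stops before row \<open>q\<close> in \<open>v\<close>, excludes that \<open>u\<close> has an entry
  above \<open>y\<close> at a position of the other parity between \<open>q\<close> and \<open>p\<close>.
\<close>

lemma largest_differing_value_even_ascent:
  assumes u: "u permutes {1..n}" and v: "v permutes {1..n}"
    and D: "odd_diagram n u = odd_diagram n v"
    and above: "\<And>z. y < z \<Longrightarrow> inv u z = inv v z"
    and less: "inv v y < inv u y"
  shows "even_ascent n u (inv v y) (inv u y)"
proof -
  define p q where "p = inv u y" and "q = inv v y"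
  have up: "u p = y" and vq: "v q = y"
    using permutes_inverses[OF u] permutes_inverses[OF v] by (simp_all add: p_def q_def)
  have qp: "q < p" using less by (simp add: p_def q_def)
  have same: "u k > y \<longleftrightarrow> v k > y" for k
  proof
    assume "u k > y"
    then have "inv v (u k) = k" using above[of "u k"] permutes_inverses(2)[OF u, of k] by simp
    then have "v k = u k" using permutes_inverses(1)[OF v, of "u k"] by simp
    then show "v k > y" using \<open>u k > y\<close> by simp
  next
    assume "v k > y"
    then have "inv u (v k) = k" using above[of "v k"] permutes_inverses(2)[OF v, of k] by simp
    then have "u k = v k" using permutes_inverses(1)[OF u, of "v k"] by simp
    then show "u k > y" using \<open>v k > y\<close> by simp
  qed
  have y_in: "y \<in> {1..n}"
  proof (rule ccontr)
    assume "y \<notin> {1..n}"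
    then have "inv u y = y" "inv v y = y"
      using permutes_not_in[OF permutes_inv[OF u]] permutes_not_in[OF permutes_inv[OF v]] by simp_all
    then show False using less by simp
  qed
  have p_in: "p \<in> {1..n}" and q_in: "q \<in> {1..n}"
    using y_in permutes_in_image[OF permutes_inv[OF u]] permutes_in_image[OF permutes_inv[OF v]]
    by (auto simp: p_def q_def)
  have "u q \<noteq> u p" using qp permutes_inj[OF u] by (simp add: inj_eq)
  then have uq: "u q < y" using same[of q] vq up by auto
  let ?O = "\<lambda>k. q < k \<and> k \<le> n \<and> q mod 2 \<noteq> k mod 2"
  define Ku Kv where "Ku = {k. ?O k \<and> u k < u q}" and "Kv = {k. ?O k \<and> v k < y}"
  have Kv_iff: "k \<in> Kv \<longleftrightarrow> ?O k \<and> u k \<le> y" for k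
  proof -
    have "v k = v q \<longleftrightarrow> k = q" using permutes_inj[OF v] by (simp add: inj_eq)
    then have "v k = y \<longleftrightarrow> k = q" by (simp add: vq)
    then show ?thesis using same[of k] by (auto simp: Kv_def)
  qed
  have "u ` Ku = v ` Kv"
  proof -
    have "u ` Ku = {j. (q, j) \<in> odd_diagram n u}"
      unfolding odd_diagram_row[OF u q_in] by (simp add: Ku_def conj_assoc)
    also have "\<dots> = v ` Kv"
      unfolding D odd_diagram_row[OF v q_in] by (simp add: Kv_def vq conj_assoc)
    finally show ?thesis .
  qed
  then have "card Ku = card Kv"
    using card_image[OF permutes_inj_on[OF u]] card_image[OF permutes_inj_on[OF v]] by metis
  moreover have "Ku \<subseteq> Kv"
    using uq unfolding Ku_def subset_eq Kv_iff by auto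
  moreover have "finite Kv" by (rule finite_subset[of _ "{..n}"]) (auto simp: Kv_def)
  ultimately have KK: "Ku = Kv" using card_subset_eq by blast
  have full: "u k < u q" if "?O k" "u k \<le> y" for k
  proof -
    have "k \<in> Ku" unfolding KK Kv_iff using that by blast
    then show ?thesis by (simp add: Ku_def)
  qed
  have par: "q mod 2 = p mod 2"
    using full[of p] up uq qp p_in by auto
  have mid: "u b < u q" if b: "q < b" "b < p" "b mod 2 \<noteq> q mod 2" for b
  proof (cases "u b \<le> y")
    case True
    then show ?thesis using full[of b] b p_in by auto
  next
    case False
    have b_in: "b \<in> {1..n}" using b p_in by auto
    have "(b, y) \<in> odd_diagram n u"
      using mem_odd_diagram_iff[OF u b_in p_in] False b par up by auto
    then have "b < q"
      using mem_odd_diagram_iff[OF v b_in q_in] by (simp add: D vq)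
    then show ?thesis using b by simp
  qed
  have right: "\<not> (u q < u d \<and> u d < u p)" if d: "p < d" "d \<le> n" "d mod 2 \<noteq> q mod 2" for d
    using full[of d] d qp up by auto
  have "even_ascent n u q p"
    using qp p_in q_in par uq up mid right by (auto simp: even_ascent_def)
  then show ?thesis by (simp add: p_def q_def)
qed

text \<open>
  The values above \<open>m\<close> already stand at their final positions; each round of the induction puts
  one more value in place.
\<close>

lemma even_swaps_to_213_avoiding_aux:
  assumes v: "v permutes {1..n}" and avoid: "avoids n v [2, 1, 3]"
    and "u permutes {1..n}" "odd_diagram n u = odd_diagram n v"
    and "\<And>z. m < z \<Longrightarrow> inv u z = inv v z"
  shows "(even_swap n)\<^sup>*\<^sup>* u v"
  using assms(3-5)
proof (induction m arbitrary: u)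
  case 0
  note u = \<open>u permutes {1..n}\<close>
  have "inv u 0 = inv v 0"
    using permutes_not_in[OF permutes_inv[OF u], of 0] permutes_not_in[OF permutes_inv[OF v], of 0]
    by simp
  then have "inv u = inv v" using 0 by (metis bot_nat_0.not_eq_extremum ext)
  then have "u = v" using permutes_inv_inv[OF u] permutes_inv_inv[OF v] by metis
  then show ?case by simp
next
  case (Suc m)
  note u = \<open>u permutes {1..n}\<close>
  let ?y = "Suc m"
  consider "inv u ?y = inv v ?y" | "inv u ?y < inv v ?y" | "inv v ?y < inv u ?y"
    by linarith
  then show ?case
  proof cases
    case 1
    then have "inv u z = inv v z" if "m < z" for z
      using Suc.prems(3) that by (cases "z = ?y") auto
    then show ?thesis using Suc by blast
  next
    case 2
    then have "even_ascent n v (inv u ?y) (inv v ?y)"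
      using largest_differing_value_even_ascent[OF v u] Suc.prems by metis
    then have False
      using avoid even_swap_source_contains_213 v unfolding even_swap_def by blast
    then show ?thesis ..
  next
    case 3
    let ?p = "inv u ?y" and ?q = "inv v ?y"
    let ?t = "Transposition.transpose ?q ?p"
    let ?u' = "u \<circ> ?t"
    have asc: "even_ascent n u ?q ?p"
      using largest_differing_value_even_ascent[OF u v] Suc.prems 3 by metis
    have u': "?u' permutes {1..n}"
      using permutes_comp_transpose[OF u] asc by (simp add: even_ascent_def)
    have inv_u': "inv ?u' z = ?t (inv u z)" for z
    proof -
      have "?u' (?t (inv u z)) = z" using permutes_inverses[OF u] by simp
      then show ?thesis using permutes_inverses(2)[OF u'] by metis
    qed
    have "inv ?u' z = inv v z" if "m < z" for z
    proof (cases "z = ?y")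
      case True
      then show ?thesis by (simp add: inv_u')
    next
      case False
      have "u ?q < u ?p" using asc by (simp add: even_ascent_def)
      moreover have "u ?p = ?y" "u (inv u z) = z" using permutes_inverses[OF u] by simp_all
      ultimately have "inv u z \<noteq> ?p" "inv u z \<noteq> ?q" using False that by auto
      then have "inv ?u' z = inv u z" by (simp add: inv_u')
      then show ?thesis using Suc.prems(3)[of z] False that by simp
    qed
    then have "(even_swap n)\<^sup>*\<^sup>* ?u' v"
      using Suc.IH[OF u'] odd_diagram_even_ascent_swap[OF u asc] Suc.prems(2) by metis
    moreover have "even_swap n u ?u'"
      using u asc by (auto simp: even_swap_def)
    ultimately show ?thesis by (meson converse_rtranclp_into_rtranclp)
  qed
qed

lemma even_swaps_to_213_avoiding:
  assumes u: "u permutes {1..n}" and v: "v permutes {1..n}"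
    and D: "odd_diagram n u = odd_diagram n v" and avoid: "avoids n v [2, 1, 3]"
  shows "(even_swap n)\<^sup>*\<^sup>* u v"
proof (rule even_swaps_to_213_avoiding_aux[OF v avoid u D])
  show "inv u z = inv v z" if "n < z" for z
    using permutes_not_in[OF permutes_inv[OF u], of z] permutes_not_in[OF permutes_inv[OF v], of z]
      that by simp
qed

section \<open>Moving down to a 312-avoiding permutation\<close>

text \<open>
  Let \<open>x = u p\<close> and let \<open>q > p\<close> be the position of \<open>x\<close> in \<open>v\<close>. The odd diagram of \<open>u\<close> has nothing
  in row \<open>p\<close> at columns \<open>\<ge> x\<close>, and nothing in column \<open>x\<close> at rows \<open>\<ge> p\<close>. Reading both facts in \<open>v\<close>
  shows that exchanging \<open>v p\<close> and \<open>x\<close> undoes a move.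
\<close>

lemma first_differing_position_even_ascent:
  assumes u: "u permutes {1..n}" and v: "v permutes {1..n}"
    and D: "odd_diagram n u = odd_diagram n v"
    and before: "\<And>i. i < p \<Longrightarrow> u i = v i"
    and less: "u p < v p"
  shows "even_ascent n (v \<circ> Transposition.transpose p (inv v (u p))) p (inv v (u p))"
proof -
  define q where "q = inv v (u p)"
  have vq: "v q = u p" using permutes_inverses[OF v] by (simp add: q_def)
  have p_in: "p \<in> {1..n}"
    using less permutes_not_in[OF u, of p] permutes_not_in[OF v, of p] by fastforce
  then have "u p \<in> {1..n}" by (simp only: permutes_in_image[OF u])
  then have q_in: "q \<in> {1..n}"
    by (simp only: q_def permutes_in_image[OF permutes_inv[OF v]])
  have "\<not> q < p" using before[of q] vq permutes_inj[OF u] by (metis injD less_irrefl)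
  moreover have "q \<noteq> p" using vq less by auto
  ultimately have pq: "p < q" by simp
  have "(p, u p) \<notin> odd_diagram n v"
    using odd_diagram_less[of p "u p" n u] D by auto
  then have par: "p mod 2 = q mod 2"
    using mem_odd_diagram_iff[OF v p_in q_in] vq pq less by auto
  have mid: "v b < u p" if b: "p < b" "b < q" "b mod 2 \<noteq> p mod 2" for b
  proof (rule ccontr)
    assume "\<not> v b < u p"
    moreover have "v b \<noteq> v q" using b permutes_inj[OF v] by (simp add: inj_eq)
    ultimately have gt: "u p < v b" using vq by simp
    have b_in: "b \<in> {1..n}" using b p_in q_in by auto
    have "(b, u p) \<in> odd_diagram n u"
      using mem_odd_diagram_iff[OF v b_in q_in] b gt par vq D by auto
    then show False using mem_odd_diagram_iff[OF u b_in p_in] b by simp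
  qed
  have right: "\<not> (u p < v d \<and> v d < v p)" if d: "q < d" "d \<le> n" "d mod 2 \<noteq> p mod 2" for d
  proof
    assume btw: "u p < v d \<and> v d < v p"
    have "d \<in> {1..n}" using d by auto
    then have "(p, v d) \<in> odd_diagram n u"
      using mem_odd_diagram_iff[OF v p_in, of d] btw d pq D by auto
    then show False using odd_diagram_less btw by fastforce
  qed
  have "even_ascent n (v \<circ> Transposition.transpose p q) p q"
    using p_in q_in pq par less vq mid right
    by (auto simp: even_ascent_def Transposition.transpose_def)
  then show ?thesis by (simp add: q_def)
qed

text \<open>
  The entries at the positions up to \<open>n - m\<close> already agree; each round of the induction makes one
  more position agree. Starting at \<open>m = n + 1\<close> makes the hypothesis void.
\<close>

lemma even_swaps_from_312_avoiding_aux: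
  assumes v: "v permutes {1..n}" and avoid: "avoids n v [3, 1, 2]"
    and "u permutes {1..n}" "odd_diagram n u = odd_diagram n v"
    and "\<And>i. i + m \<le> n \<Longrightarrow> u i = v i"
  shows "(even_swap n)\<^sup>*\<^sup>* v u"
  using assms(3-5)
proof (induction m arbitrary: u)
  case 0
  note u = \<open>u permutes {1..n}\<close>
  have "u i = v i" for i
    using 0(3)[of i] permutes_not_in[OF u, of i] permutes_not_in[OF v, of i]
    by (cases "i \<le> n") auto
  then have "u = v" by blast
  then show ?case by simp
next
  case (Suc m)
  note u = \<open>u permutes {1..n}\<close>
  let ?p = "n - m"
  have before: "u i = v i" if "i < ?p" for i
    using Suc.prems(3)[of i] that by simp
  consider "u ?p = v ?p" | "u ?p < v ?p" | "v ?p < u ?p" by linarith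
  then show ?case
  proof cases
    case 1
    have "u i = v i" if "i + m \<le> n" for i
      using before[of i] 1 that by (cases "i = ?p") auto
    then show ?thesis using Suc by blast
  next
    case 2
    let ?q = "inv v (u ?p)"
    let ?t = "Transposition.transpose ?p ?q"
    have asc: "even_ascent n (v \<circ> ?t) ?p ?q"
      using first_differing_position_even_ascent[OF u v] Suc.prems(2) before 2 by blast
    have perm: "v \<circ> ?t permutes {1..n}"
      using permutes_comp_transpose[OF v] asc by (simp add: even_ascent_def)
    have "v = (v \<circ> ?t) \<circ> ?t" by (simp add: comp_assoc)
    then have "even_swap n (v \<circ> ?t) v"
      using asc perm unfolding even_swap_def by blast
    then show ?thesis
      using avoid even_swap_target_contains_312 by blast
  next
    case 3
    let ?q = "inv u (v ?p)"
    let ?t = "Transposition.transpose ?p ?q"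
    let ?u' = "u \<circ> ?t"
    have asc: "even_ascent n ?u' ?p ?q"
      using first_differing_position_even_ascent[OF v u] Suc.prems(2) before 3 by metis
    have u': "?u' permutes {1..n}"
      using permutes_comp_transpose[OF u] asc by (simp add: even_ascent_def)
    have u_eq: "u = ?u' \<circ> ?t" by (simp add: comp_assoc)
    then have "even_swap n ?u' u"
      using asc u' unfolding even_swap_def by blast
    moreover have "odd_diagram n ?u' = odd_diagram n v"
      using odd_diagram_even_ascent_swap[OF u' asc] u_eq Suc.prems(2) by simp
    moreover have "?u' i = v i" if "i + m \<le> n" for i
    proof (cases "i = ?p")
      case True
      then show ?thesis using permutes_inverses[OF u] by simp
    next
      case False
      then have "i < ?p" using that by simp
      moreover have "?p < ?q" using asc by (simp add: even_ascent_def)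
      ultimately show ?thesis using before[of i] by (simp add: Transposition.transpose_def)
    qed
    ultimately show ?thesis
      using Suc.IH[OF u'] by (meson rtranclp.rtrancl_into_rtrancl)
  qed
qed

lemma even_swaps_from_312_avoiding:
  assumes "u permutes {1..n}" "v permutes {1..n}"
    and "odd_diagram n u = odd_diagram n v" "avoids n v [3, 1, 2]"
  shows "(even_swap n)\<^sup>*\<^sup>* v u"
  by (rule even_swaps_from_312_avoiding_aux[of v n u "Suc n"]) (use assms in auto)

section \<open>Extremal elements of odd diagram classes\<close>

theorem theorem1:
  fixes n :: nat and C :: "(nat \<Rightarrow> nat) set"
  assumes "n \<ge> 1"
    and "odd_diagram_class n C"
  shows "(\<exists>\<^sub>\<le>\<^sub>1 v. v \<in> C \<and> avoids n v [2, 1, 3]) \<and>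
         (\<exists>\<^sub>\<le>\<^sub>1 v. v \<in> C \<and> avoids n v [3, 1, 2]) \<and>
         (\<forall>v\<in>C. avoids n v [2, 1, 3] \<longrightarrow> (\<forall>u\<in>C. bruhat_le n u v)) \<and>
         (\<forall>v'\<in>C. avoids n v' [3, 1, 2] \<longrightarrow> (\<forall>u\<in>C. bruhat_le n v' u))"
proof -
  obtain D where C: "C = {w. w permutes {1..n} \<and> odd_diagram n w = D}"
    using assms(2) by (auto simp: odd_diagram_class_def)
  have up: "(even_swap n)\<^sup>*\<^sup>* u v" if "u \<in> C" "v \<in> C" "avoids n v [2, 1, 3]" for u v
    using that even_swaps_to_213_avoiding by (simp add: C)
  have down: "(even_swap n)\<^sup>*\<^sup>* v u" if "u \<in> C" "v \<in> C" "avoids n v [3, 1, 2]" for u v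
    using that even_swaps_from_312_avoiding by (simp add: C)
  have "\<exists>\<^sub>\<le>\<^sub>1 v. v \<in> C \<and> avoids n v [2, 1, 3]"
  proof (rule Uniq_I)
    fix u v assume u: "u \<in> C \<and> avoids n u [2, 1, 3]" and v: "v \<in> C \<and> avoids n v [2, 1, 3]"
    then have "(even_swap n)\<^sup>*\<^sup>* u v" using up by blast
    then show "u = v"
      by (cases rule: converse_rtranclpE) (use u even_swap_source_contains_213 in auto)
  qed
  moreover have "\<exists>\<^sub>\<le>\<^sub>1 v. v \<in> C \<and> avoids n v [3, 1, 2]"
  proof (rule Uniq_I)
    fix u v assume u: "u \<in> C \<and> avoids n u [3, 1, 2]" and v: "v \<in> C \<and> avoids n v [3, 1, 2]"
    then have "(even_swap n)\<^sup>*\<^sup>* u v" using down by blast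
    then show "u = v"
      by (cases rule: rtranclp.cases) (use v even_swap_target_contains_312 in auto)
  qed
  ultimately show ?thesis
    using up down even_swap_rtranclp_imp_bruhat_le by blast
qed

end
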